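(* Let $P_1(x_1,y_1),\dots,P_n(x_n,y_n)$ be $n$ points in $\mathbb{R}^2$ ($n\ge 3$) with $x_1<\cdots<x_n$. Then $\overline{P_1P_2},\overline{P_2P_3},\dots,\overline{P_{n-1}P_n},\overline{P_nP_1}$ form a convex $n$-gon in the half-space $$\underline{\mathscr{H}}=\bigg\{(x,y)\;\bigg|\; x\in\mathbb{R}\ \text{ and }\ y\le y_1+\Big(\frac{x-x_1}{x_n-x_1}\Big)(y_n-y_1)\bigg\}\subseteq\mathbb{R}^2$$ if and only if the following inequality holds: $$\frac{y_i-y_{i-1}}{x_i-x_{i-1}}\le\frac{y_{i+1}-y_i}{x_{i+1}-x_i}\qquad\text{for all } i\in\{2,\dots,n-1\}.$$
   Context: $\mathbb{R}$ denotes the set of real numbers and $\mathbb{R}^2$ the usual two-dimensional plane. $P_i(x_i,y_i)$ denotes the point $P_i$ with coordinates $(x_i,y_i)$, and $\overline{PQ}$ denotes the line segment joining the points $P$ and $Q$. A convex $n$-gon is a convex polygon with $n$ sides; here the sides are the listed segments. *)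

theory Defs
  imports "HOL-Analysis.Analysis"
begin

text \<open>Vertices are indexed by \<open>1, \<dots>, n\<close>; the last side joins \<open>P n\<close> back to \<open>P 1\<close>.\<close>

definition cyc_next :: "nat \<Rightarrow> nat \<Rightarrow> nat" where
  "cyc_next n i = (if i = n then 1 else i + 1)"

definition side :: "nat \<Rightarrow> (nat \<Rightarrow> real \<times> real) \<Rightarrow> nat \<Rightarrow> (real \<times> real) set" where
  "side n P i = closed_segment (P i) (P (cyc_next n i))"

definition simple_sides :: "nat \<Rightarrow> (nat \<Rightarrow> real \<times> real) \<Rightarrow> bool" where
  "simple_sides n P \<longleftrightarrow>
     (\<forall>i\<in>{1..n}. \<forall>j\<in>{1..n}. i \<noteq> j \<longrightarrow>
        side n P i \<inter> side n P j \<subseteq> {P i, P (cyc_next n i)} \<inter> {P j, P (cyc_next n j)})"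

text \<open>
  \<open>convex_ngon n P K\<close>: the \<open>n\<close> segments \<open>side n P i\<close> form the convex \<open>n\<close>-gon \<open>K\<close> (as a closed
  region), i.e. together they are the boundary of the convex set \<open>K\<close>. Straight angles are
  allowed: three consecutive vertices may be collinear. A flat \<open>n\<close>-gon, whose vertices all lie on
  one line, is also admitted: then \<open>K\<close> is a segment, which has empty interior and is its own
  frontier in the plane. The sides of a flat \<open>n\<close>-gon necessarily overlap, so simplicity of the
  boundary is only required when \<open>K\<close> has interior points.
\<close>

definition convex_ngon :: "nat \<Rightarrow> (nat \<Rightarrow> real \<times> real) \<Rightarrow> (real \<times> real) set \<Rightarrow> bool" where
  "convex_ngon n P K \<longleftrightarrow>
     3 \<le> n \<and> inj_on P {1..n} \<and> compact K \<and> convex K \<and>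
     (\<Union>i\<in>{1..n}. side n P i) = frontier K \<and>
     (interior K \<noteq> {} \<longrightarrow> simple_sides n P)"

end

theory Submission
  imports Defs
begin

text \<open>
  The proof rests on the behaviour of the polygon along vertical lines. Since the abscissae increase,
  each side is the graph of an affine function over an interval: the sides \<open>1, \<dots>, n - 1\<close> make up
  the graph of a piecewise affine function on \<open>[x 1, x n]\<close>, and side \<open>n\<close> is the graph of the
  chord (the \<^emph>\<open>base\<close>) over the same interval.

  If the slopes are nondecreasing, each edge lies on the upper envelope of the lines carrying all the
  edges (\<open>edge_le_edge\<close>), and this envelope is nowhere above the base (\<open>edge_le_base\<close>). The region
  between envelope and base is cut out by finitely many closed half-planes, so it is convex, and a
  point of it is on the frontier exactly when a lower or the upper constraint is tight, that is, when
  it is on a side (\<open>frontier_region\<close>). Two distinct edges can only meet at a shared abscissa; an edge that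
  touches the base away from \<open>x 1\<close> and \<open>x n\<close> is carried by the base line, which squeezes
  the region into a line. This gives simplicity as soon as the region has interior points.

  Conversely, let the sides bound a compact convex set \<open>K\<close> below the base, and suppose that the
  slope drops at \<open>P i\<close>. Then the segment from \<open>P (i - 1)\<close> to \<open>P (i + 1)\<close>, which is in
  \<open>K\<close>, passes strictly below \<open>P i\<close>. The lowest point of \<open>K\<close> on the vertical line through
  \<open>P i\<close> is on the frontier and strictly below \<open>P i\<close>; but on this line the sides
  contain only \<open>P i\<close> and a point of the base, which is not below \<open>P i\<close>.
\<close>

section \<open>Nonvertical lines and segments in the plane\<close>

definition line_through :: "real \<times> real \<Rightarrow> real \<times> real \<Rightarrow> real \<Rightarrow> real" where
  "line_through p q u = snd p + ((u - fst p) / (fst q - fst p)) * (snd q - snd p)"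

lemma line_through_affine: "\<exists>c m. \<forall>u. line_through p q u = c + m * u"
proof (intro exI allI)
  fix u
  show "line_through p q u =
      (snd p - fst p * ((snd q - snd p) / (fst q - fst p))) + (snd q - snd p) / (fst q - fst p) * u"
    unfolding line_through_def by (simp add: divide_inverse algebra_simps)
qed

lemma line_through_left [simp]: "line_through (a, b) q a = b"
  by (simp add: line_through_def)

lemma line_through_right [simp]: "a \<noteq> c \<Longrightarrow> line_through (a, b) (c, d) c = d"
  by (simp add: line_through_def)

lemma line_through_commute:
  assumes "fst p \<noteq> fst q"
  shows "line_through p q u = line_through q p u"
proof -
  have "fst q - fst p \<noteq> 0" "fst p - fst q \<noteq> 0" using assms by auto
  then show ?thesis by (simp add: line_through_def divide_simps) (simp add: algebra_simps)
qed

lemma continuous_on_line_through [continuous_intros]: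
  assumes "continuous_on S f"
  shows "continuous_on S (\<lambda>z. line_through p q (f z))"
proof -
  obtain c m where "\<And>u. line_through p q u = c + m * u" using line_through_affine[of p q] by blast
  then show ?thesis by (simp add: assms continuous_intros)
qed

lemma mem_segment_iff_graph:
  assumes "fst p < fst q"
  shows "(u, v) \<in> closed_segment p q \<longleftrightarrow> fst p \<le> u \<and> u \<le> fst q \<and> v = line_through p q u"
proof
  assume "(u, v) \<in> closed_segment p q"
  then obtain t where t: "0 \<le> t" "t \<le> 1" "(u, v) = (1 - t) *\<^sub>R p + t *\<^sub>R q"
    by (auto simp: in_segment)
  have u: "u - fst p = t * (fst q - fst p)" and v: "v = snd p + t * (snd q - snd p)"
    using arg_cong[OF t(3), of fst] arg_cong[OF t(3), of snd] by (simp_all add: algebra_simps)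
  have "0 \<le> t * (fst q - fst p)" "t * (fst q - fst p) \<le> fst q - fst p"
    using t assms by (simp_all add: mult_left_le_one_le)
  moreover have "v = line_through p q u"
    using assms by (simp add: line_through_def u v)
  ultimately show "fst p \<le> u \<and> u \<le> fst q \<and> v = line_through p q u" using u by linarith
next
  assume *: "fst p \<le> u \<and> u \<le> fst q \<and> v = line_through p q u"
  define t where "t = (u - fst p) / (fst q - fst p)"
  have "0 \<le> t" "t \<le> 1" using * assms by (auto simp: t_def)
  moreover have "u = fst p + t * (fst q - fst p)" using assms by (simp add: t_def)
  moreover have "v = snd p + t * (snd q - snd p)" using * by (simp add: t_def line_through_def)
  ultimately show "(u, v) \<in> closed_segment p q"
    by (auto simp: in_segment prod_eq_iff algebra_simps intro!: exI[of _ t])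
qed

text \<open>
  A difference of affine functions is affine, so its value at \<open>u\<close> is the weighted mean of its
  values at \<open>a\<close> and \<open>b\<close>, and both weights are positive when \<open>u\<close> is strictly between.
\<close>

lemma line_through_le_between:
  assumes "line_through p q a \<le> line_through r s a" "line_through p q b \<le> line_through r s b"
    and "a \<le> u" "u \<le> b"
  shows "line_through p q u \<le> line_through r s u"
proof (cases "a = b")
  case False
  obtain c m where f: "\<And>u. line_through p q u = c + m * u" using line_through_affine[of p q] by blast
  obtain d k where g: "\<And>u. line_through r s u = d + k * u" using line_through_affine[of r s] by blast
  have "0 \<le> (b - u) * (d + k * a - (c + m * a)) + (u - a) * (d + k * b - (c + m * b))"
    using assms by (intro add_nonneg_nonneg mult_nonneg_nonneg) (simp_all add: f g)
  also have "\<dots> = (b - a) * (d + k * u - (c + m * u))" by algebra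
  finally show ?thesis using assms False by (simp add: f g zero_le_mult_iff)
qed (use assms in auto)

lemma line_through_eq_of_touch:
  assumes "line_through p q a \<le> line_through r s a" "line_through p q b \<le> line_through r s b"
    and "a < u" "u < b" and touch: "line_through p q u = line_through r s u"
  shows "line_through p q = line_through r s"
proof -
  obtain c m where f: "\<And>u. line_through p q u = c + m * u" using line_through_affine[of p q] by blast
  obtain d k where g: "\<And>u. line_through r s u = d + k * u" using line_through_affine[of r s] by blast
  have "(m - k) * (a - u) \<le> 0" "(m - k) * (b - u) \<le> 0"
    using assms by (simp_all add: f g algebra_simps)
  then have "m = k" using assms by (auto simp: mult_le_0_iff)
  then show ?thesis using touch by (auto simp: f g)
qed

lemma convex_above_line: "convex {z. line_through p q (fst z) \<le> snd z}"
proof -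
  obtain c m where f: "\<And>u. line_through p q u = c + m * u" using line_through_affine[of p q] by blast
  have "{z. line_through p q (fst z) \<le> snd z} = {z. inner (m, -1) z \<le> - c}"
    by (auto simp: f inner_prod_def)
  then show ?thesis by (simp add: convex_halfspace_le)
qed

lemma convex_below_line: "convex {z. snd z \<le> line_through p q (fst z)}"
proof -
  obtain c m where f: "\<And>u. line_through p q u = c + m * u" using line_through_affine[of p q] by blast
  have "{z. snd z \<le> line_through p q (fst z)} = {z. inner (m, -1) z \<ge> - c}"
    by (auto simp: f inner_prod_def)
  then show ?thesis by (simp add: convex_halfspace_ge)
qed

lemma interior_vertical_room:
  fixes S :: "(real \<times> real) set"
  assumes "(u, v) \<in> interior S"
  obtains e where "e > 0" "(u, v + e) \<in> S" "(u, v - e) \<in> S"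
proof -
  obtain e where e: "e > 0" "cball (u, v) e \<subseteq> S" using assms by (auto simp: mem_interior_cball)
  have "(u, v + e) \<in> cball (u, v) e" "(u, v - e) \<in> cball (u, v) e"
    using e(1) by (auto simp: dist_Pair_Pair dist_real_def)
  then show thesis using that e by blast
qed

section \<open>Polygons over a chain of increasing abscissae\<close>

locale x_increasing_polygon =
  fixes n :: nat and x y :: "nat \<Rightarrow> real"
  assumes three_le: "3 \<le> n" and mono_x: "strict_mono_on {1..n} x"
begin

abbreviation P :: "nat \<Rightarrow> real \<times> real" where
  "P i \<equiv> (x i, y i)"

abbreviation edge :: "nat \<Rightarrow> real \<Rightarrow> real" where
  "edge i \<equiv> line_through (P i) (P (i + 1))"

abbreviation base :: "real \<Rightarrow> real" where
  "base \<equiv> line_through (P 1) (P n)"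

definition region :: "(real \<times> real) set" where
  "region = {(u, v). x 1 \<le> u \<and> u \<le> x n \<and> (\<forall>i\<in>{1..<n}. edge i u \<le> v) \<and> v \<le> base u}"

lemma x_less: "1 \<le> i \<Longrightarrow> i < j \<Longrightarrow> j \<le> n \<Longrightarrow> x i < x j"
  using mono_x by (auto simp: strict_mono_on_def)

lemma x_le: "1 \<le> i \<Longrightarrow> i \<le> j \<Longrightarrow> j \<le> n \<Longrightarrow> x i \<le> x j"
  using x_less[of i j] by (cases "i = j") auto

lemma edge_right: "1 \<le> i \<Longrightarrow> i < n \<Longrightarrow> edge i (x (i + 1)) = y (i + 1)"
  using x_less[of i "i + 1"] by simp

lemma base_right: "base (x n) = y n"
  using x_less[of 1 n] three_le by simp

lemma mem_side_edge:
  assumes "1 \<le> i" "i < n"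
  shows "(u, v) \<in> side n P i \<longleftrightarrow> x i \<le> u \<and> u \<le> x (i + 1) \<and> v = edge i u"
  using mem_segment_iff_graph[of "P i" "P (i + 1)" u v] x_less[of i "i + 1"] assms
  by (simp add: side_def cyc_next_def)

lemma mem_side_base:
  "(u, v) \<in> side n P n \<longleftrightarrow> x 1 \<le> u \<and> u \<le> x n \<and> v = base u"
  using mem_segment_iff_graph[of "P 1" "P n" u v] x_less[of 1 n] three_le
  by (simp add: side_def cyc_next_def closed_segment_commute)

lemma exists_edge_over:
  assumes "x 1 \<le> u" "u \<le> x n"
  obtains j where "1 \<le> j" "j < n" "x j \<le> u" "u \<le> x (j + 1)"
proof -
  have "\<exists>j. 1 \<le> j \<and> j < m \<and> x j \<le> u \<and> u \<le> x (j + 1)" if "2 \<le> m" "u \<le> x m" for m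
    using that
  proof (induction m rule: nat_induct_at_least)
    case base
    then show ?case using assms by (intro exI[of _ 1]) (simp add: numeral_2_eq_2)
  next
    case (Suc m)
    show ?case
    proof (cases "u \<le> x m")
      case True
      with Suc.IH obtain j where "1 \<le> j \<and> j < m \<and> x j \<le> u \<and> u \<le> x (j + 1)" by blast
      then show ?thesis by (intro exI[of _ j]) auto
    next
      case False
      then show ?thesis using Suc by (intro exI[of _ m]) auto
    qed
  qed
  from this[of n] show thesis using assms three_le that by auto
qed

lemma Union_sides:
  "(u, v) \<in> (\<Union>i\<in>{1..n}. side n P i) \<longleftrightarrow>
     (\<exists>i\<in>{1..<n}. x i \<le> u \<and> u \<le> x (i + 1) \<and> v = edge i u)
     \<or> x 1 \<le> u \<and> u \<le> x n \<and> v = base u"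
proof -
  have "{1..n} = insert n {1..<n}" using three_le by auto
  then show ?thesis using mem_side_edge[of _ u v] by (auto simp: mem_side_base)
qed

lemma Union_sides_over_vertex:
  assumes "(x i, v) \<in> (\<Union>j\<in>{1..n}. side n P j)" "1 \<le> i" "i \<le> n"
  shows "v = y i \<or> v = base (x i)"
proof -
  have "v = y i" if "1 \<le> j" "j < n" "x j \<le> x i" "x i \<le> x (j + 1)" "v = edge j (x i)" for j
  proof -
    have "j \<le> i" "i \<le> j + 1"
      using x_less[of i j] x_less[of "j + 1" i] that assms by linarith+
    then consider "i = j" | "i = j + 1" by linarith
    then show ?thesis using that edge_right[of j] by cases auto
  qed
  then show ?thesis using assms(1) unfolding Union_sides by auto
qed

section \<open>A convex polygon below its base has nondecreasing slopes\<close>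

text \<open>
  Clearing denominators, both inequalities say that the triangle
  \<open>P (i - 1)\<close>, \<open>P i\<close>, \<open>P (i + 1)\<close> is traversed clockwise.
\<close>

lemma below_vertex_of_slope_drop:
  assumes "a < b" "b < (c :: real)" "(q - p) / (b - a) > (r - q) / (c - b)"
  shows "line_through (a, p) (c, r) b < q"
proof -
  have "(r - q) * (b - a) < (q - p) * (c - b)"
    using assms by (simp add: divide_simps mult.commute)
  then have "(b - a) * (r - p) < (q - p) * (c - a)" by (simp add: algebra_simps)
  then show ?thesis using assms by (simp add: line_through_def field_simps)
qed

text \<open>
  At a slope drop, the lowest point of \<open>K\<close> on the vertical line through the vertex would be a
  frontier point that no side contains.
\<close>

lemma slope_mono_of_convex_ngon:
  assumes ngon: "convex_ngon n P K" and below: "\<And>u v. (u, v) \<in> K \<Longrightarrow> v \<le> base u"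
    and i: "2 \<le> i" "i < n"
  shows "(y i - y (i - 1)) / (x i - x (i - 1)) \<le> (y (i + 1) - y i) / (x (i + 1) - x i)"
proof (rule ccontr)
  assume neg: "\<not> ?thesis"
  have K: "compact K" "convex K" and fr: "(\<Union>j\<in>{1..n}. side n P j) = frontier K"
    using ngon by (auto simp: convex_ngon_def)
  have vertex: "P j \<in> K" if "1 \<le> j" "j \<le> n" for j
  proof -
    have "P j \<in> side n P j" by (simp add: side_def)
    then have "P j \<in> frontier K" using that fr by auto
    then show ?thesis using K frontier_subset_compact by blast
  qed
  have ord: "x (i - 1) < x i" "x i < x (i + 1)" using x_less i by auto
  define m where "m = line_through (P (i - 1)) (P (i + 1)) (x i)"
  have m: "m < y i" using below_vertex_of_slope_drop[OF ord] neg by (simp add: m_def)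
  have "(x i, m) \<in> closed_segment (P (i - 1)) (P (i + 1))"
    using mem_segment_iff_graph[of "P (i - 1)" "P (i + 1)"] ord by (simp add: m_def)
  moreover have "P (i - 1) \<in> K" "P (i + 1) \<in> K" by (rule vertex; use i in linarith)+
  ultimately have mK: "(x i, m) \<in> K"
    using closed_segment_subset K(2) by blast
  have "\<exists>z\<in>K \<inter> {z. fst z = x i}. \<forall>w\<in>K \<inter> {z. fst z = x i}. snd z \<le> snd w"
  proof (rule continuous_attains_inf)
    show "compact (K \<inter> {z. fst z = x i})"
      by (intro compact_Int_closed K closed_Collect_eq continuous_intros)
    show "K \<inter> {z. fst z = x i} \<noteq> {}" using mK by force
    show "continuous_on (K \<inter> {z. fst z = x i}) snd" by (intro continuous_intros)
  qed
  then obtain z where z: "z \<in> K" "fst z = x i" and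
    low: "\<And>w. w \<in> K \<Longrightarrow> fst w = x i \<Longrightarrow> snd z \<le> snd w"
    by blast
  define v where "v = snd z"
  have zv: "z = (x i, v)" using z by (simp add: v_def prod_eq_iff)
  have "v \<le> m" using low[OF mK] by (simp add: v_def)
  have "z \<notin> interior K"
  proof
    assume "z \<in> interior K"
    then obtain e where "e > 0" "(x i, v - e) \<in> K"
      unfolding zv by (rule interior_vertical_room)
    then show False using low[of "(x i, v - e)"] by (simp add: v_def)
  qed
  then have "z \<in> frontier K" using z closure_subset by (auto simp: frontier_def)
  then have "v = y i \<or> v = base (x i)"
    using Union_sides_over_vertex[of i v] i unfolding fr zv by simp
  moreover have "y i \<le> base (x i)" using below[OF vertex[of i]] i by simp
  ultimately show False using m \<open>v \<le> m\<close> by linarith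
qed

end

section \<open>Nondecreasing slopes give a convex polygon\<close>

locale slope_increasing_polygon = x_increasing_polygon +
  assumes slope_mono: "\<And>i. 2 \<le> i \<Longrightarrow> i < n \<Longrightarrow>
    (y i - y (i - 1)) / (x i - x (i - 1)) \<le> (y (i + 1) - y i) / (x (i + 1) - x i)"
begin

text \<open>Consecutive edge lines cross at their common vertex, and the later one is at
  least as steep.\<close>

lemma edge_vs_next:
  assumes "1 \<le> i" "i + 1 < n"
  shows "x (i + 1) \<le> u \<Longrightarrow> edge i u \<le> edge (i + 1) u"
    and "u \<le> x (i + 1) \<Longrightarrow> edge (i + 1) u \<le> edge i u"
proof -
  define s t where "s = (y (i + 1) - y i) / (x (i + 1) - x i)"
    and "t = (y (i + 2) - y (i + 1)) / (x (i + 2) - x (i + 1))"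
  have st: "s \<le> t" using slope_mono[of "i + 1"] assms by (simp add: s_def t_def)
  have i: "edge i u = y (i + 1) + s * (u - x (i + 1))"
    using line_through_commute[of "P i" "P (i + 1)" u] x_less[of i "i + 1"] assms
    by (simp add: line_through_def s_def) (simp add: divide_simps, simp add: algebra_simps)
  have j: "edge (i + 1) u = y (i + 1) + t * (u - x (i + 1))"
    by (simp add: line_through_def t_def)
  show "edge i u \<le> edge (i + 1) u" if "x (i + 1) \<le> u"
    unfolding i j using mult_right_mono[OF st, of "u - x (i + 1)"] that by simp
  show "edge (i + 1) u \<le> edge i u" if "u \<le> x (i + 1)"
    unfolding i j using mult_right_mono_neg[OF st, of "u - x (i + 1)"] that by simp
qed

lemma edge_le_edge_right:
  assumes "i \<le> j" "1 \<le> i" "j < n" "x j \<le> u"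
  shows "edge i u \<le> edge j u"
  using assms
proof (induction j rule: dec_induct)
  case (step k)
  have "x k \<le> u" using x_le[of k "Suc k"] step by simp
  then have "edge i u \<le> edge k u" using step by simp
  also have "\<dots> \<le> edge (k + 1) u" using edge_vs_next(1)[of k u] step by simp
  finally show ?case by simp
qed simp

lemma edge_le_edge_left:
  assumes "j \<le> i" "1 \<le> j" "i < n" "u \<le> x (j + 1)"
  shows "edge i u \<le> edge j u"
  using assms
proof (induction i rule: dec_induct)
  case (step k)
  have "u \<le> x (k + 1)" using x_le[of "j + 1" "k + 1"] step by simp
  then have "edge (k + 1) u \<le> edge k u" using edge_vs_next(2)[of k u] step by simp
  also have "\<dots> \<le> edge j u" using step by simp
  finally show ?case by simp
qed simp

lemma edge_le_edge:
  assumes "1 \<le> i" "i < n" "1 \<le> j" "j < n" "x j \<le> u" "u \<le> x (j + 1)"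
  shows "edge i u \<le> edge j u"
  using edge_le_edge_right[of i j u] edge_le_edge_left[of j i u] assms by linarith

lemma edge_le_base_ends:
  assumes "1 \<le> i" "i < n"
  shows "edge i (x 1) \<le> base (x 1)" "edge i (x n) \<le> base (x n)"
proof -
  show "edge i (x 1) \<le> base (x 1)"
    using edge_le_edge[of i 1 "x 1"] x_le[of 1 "1 + 1"] assms three_le by simp
  have "edge i (x n) \<le> edge (n - 1) (x n)"
    using edge_le_edge[of i "n - 1" "x n"] x_le[of "n - 1" n] assms three_le by simp
  also have "\<dots> = y n" using edge_right[of "n - 1"] three_le by simp
  finally show "edge i (x n) \<le> base (x n)" unfolding base_right .
qed

lemma edge_le_base:
  "1 \<le> i \<Longrightarrow> i < n \<Longrightarrow> x 1 \<le> u \<Longrightarrow> u \<le> x n \<Longrightarrow> edge i u \<le> base u"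
  by (rule line_through_le_between[OF edge_le_base_ends])

lemma region_halfspaces:
  "region = {z. x 1 \<le> fst z} \<inter> {z. fst z \<le> x n} \<inter>
     (\<Inter>i\<in>{1..<n}. {z. edge i (fst z) \<le> snd z}) \<inter> {z. snd z \<le> base (fst z)}"
  by (auto simp: region_def)

lemma convex_region: "convex region"
proof -
  have "{z :: real \<times> real. x 1 \<le> fst z} = {z. inner (1, 0) z \<ge> x 1}"
    "{z :: real \<times> real. fst z \<le> x n} = {z. inner (1, 0) z \<le> x n}"
    by (auto simp: inner_prod_def)
  then show ?thesis unfolding region_halfspaces
    by (auto intro!: convex_Int convex_INT convex_above_line convex_below_line
        simp: convex_halfspace_le convex_halfspace_ge)
qed

lemma compact_region: "compact region"
proof -
  have "closed region"
    unfolding region_halfspaces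
    by (intro closed_Int closed_INT ballI closed_Collect_le continuous_intros)
  moreover have "bounded region"
  proof -
    have "bounded (edge 1 ` {x 1..x n})" "bounded (base ` {x 1..x n})"
      by (intro compact_imp_bounded compact_continuous_image continuous_intros compact_Icc)+
    then obtain a b where ab: "\<forall>u\<in>{x 1..x n}. \<bar>edge 1 u\<bar> \<le> a"
      "\<forall>u\<in>{x 1..x n}. \<bar>base u\<bar> \<le> b"
      unfolding bounded_real ball_simps by blast
    have "region \<subseteq> {x 1..x n} \<times> {-a..b}"
    proof (rule subrelI)
      fix u v
      assume uv: "(u, v) \<in> region"
      then have u: "u \<in> {x 1..x n}" and "edge 1 u \<le> v" "v \<le> base u"
        using three_le by (auto simp: region_def)
      moreover have "\<bar>edge 1 u\<bar> \<le> a" "\<bar>base u\<bar> \<le> b" using ab u by blast+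
      ultimately show "(u, v) \<in> {x 1..x n} \<times> {-a..b}" by auto
    qed
    then show ?thesis using bounded_Times bounded_subset bounded_closed_interval by metis
  qed
  ultimately show ?thesis by (simp add: compact_eq_bounded_closed)
qed

text \<open>
  A tight constraint is violated by an arbitrarily small vertical move. The converse says that
  the bounds \<open>x 1 \<le> u \<le> x n\<close> add nothing to the frontier: over the two ends the other
  constraints are tight already.
\<close>

lemma mem_interior_region:
  assumes "(u, v) \<in> region"
  shows "(u, v) \<in> interior region \<longleftrightarrow> (\<forall>i\<in>{1..<n}. edge i u < v) \<and> v < base u"
proof
  assume "(u, v) \<in> interior region"
  then obtain e where "e > 0" "(u, v + e) \<in> region" "(u, v - e) \<in> region"
    by (rule interior_vertical_room)
  then have "v + e \<le> base u" "\<forall>i\<in>{1..<n}. edge i u \<le> v - e" by (auto simp: region_def)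
  then show "(\<forall>i\<in>{1..<n}. edge i u < v) \<and> v < base u" using \<open>e > 0\<close> by fastforce
next
  assume strict: "(\<forall>i\<in>{1..<n}. edge i u < v) \<and> v < base u"
  \<comment> \<open>Over an end of the base, the adjacent edge leaves no room, so \<open>u\<close> is strictly inside.\<close>
  have "1 \<in> {1..<n}" "n - 1 \<in> {1..<n}" using three_le by auto
  then have ends: "edge 1 u < base u" "edge (n - 1) u < base u"
    using strict order_less_trans by blast+
  have "u \<noteq> x 1" using ends(1) by auto
  moreover have "u \<noteq> x n" using ends(2) edge_right[of "n - 1"] base_right three_le by auto
  ultimately have u: "x 1 < u" "u < x n" using assms by (auto simp: region_def)
  define U where "U = {z. x 1 < fst z} \<inter> {z. fst z < x n} \<inter>
     (\<Inter>i\<in>{1..<n}. {z. edge i (fst z) < snd z}) \<inter> {z. snd z < base (fst z)}"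
  have "open U" unfolding U_def
    by (intro open_Int open_INT ballI finite_atLeastLessThan open_Collect_less continuous_intros)
  moreover have "U \<subseteq> region" by (auto simp: U_def region_def less_imp_le)
  moreover have "(u, v) \<in> U" using strict u by (auto simp: U_def)
  ultimately show "(u, v) \<in> interior region" by (meson interiorI)
qed

lemma frontier_region: "(\<Union>i\<in>{1..n}. side n P i) = frontier region"
proof -
  have fr: "frontier region = region - interior region"
    using compact_imp_closed[OF compact_region] by (simp add: frontier_def)
  have "(u, v) \<in> (\<Union>i\<in>{1..n}. side n P i) \<longleftrightarrow> (u, v) \<in> frontier region" for u v
  proof
    assume "(u, v) \<in> (\<Union>i\<in>{1..n}. side n P i)"
    then consider j where "1 \<le> j" "j < n" "x j \<le> u" "u \<le> x (j + 1)" "v = edge j u"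
      | "x 1 \<le> u" "u \<le> x n" "v = base u" unfolding Union_sides by auto
    then show "(u, v) \<in> frontier region"
    proof cases
      case 1
      have "x 1 \<le> u" "u \<le> x n" using 1 x_le[of 1 j] x_le[of "j + 1" n] by auto
      then have "(u, v) \<in> region"
        using 1 edge_le_edge[of _ j u] edge_le_base[of j u] by (auto simp: region_def)
      moreover have "j \<in> {1..<n}" "\<not> edge j u < v" using 1 by auto
      ultimately show ?thesis unfolding fr using mem_interior_region by blast
    next
      case 2
      have "(u, v) \<in> region" using 2 edge_le_base by (auto simp: region_def)
      moreover have "\<not> v < base u" using 2 by simp
      ultimately show ?thesis unfolding fr using mem_interior_region by blast
    qed
  next
    assume "(u, v) \<in> frontier region"
    then have R: "(u, v) \<in> region" and tight: "\<not> ((\<forall>i\<in>{1..<n}. edge i u < v) \<and> v < base u)"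
      unfolding fr using mem_interior_region by blast+
    have "\<forall>i\<in>{1..<n}. edge i u \<le> v" "v \<le> base u" using R by (auto simp: region_def)
    then consider i where "i \<in> {1..<n}" "v = edge i u" | "v = base u"
      using tight by (metis order_le_less)
    then show "(u, v) \<in> (\<Union>i\<in>{1..n}. side n P i)"
    proof cases
      case 1
      obtain j where j: "1 \<le> j" "j < n" "x j \<le> u" "u \<le> x (j + 1)"
        using exists_edge_over[of u] R by (auto simp: region_def)
      \<comment> \<open>The tight line \<open>i\<close> need not carry the edge over \<open>u\<close>, but edge \<open>j\<close> is then
        tight as well.\<close>
      have "v \<le> edge j u" using edge_le_edge[of i j u] j 1 by auto
      moreover have "edge j u \<le> v" using R j by (auto simp: region_def)
      ultimately show ?thesis using j unfolding Union_sides by auto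
    next
      case 2
      then show ?thesis using R unfolding Union_sides by (auto simp: region_def)
    qed
  qed
  then show ?thesis by auto
qed

text \<open>
  Interior points are needed only for an edge meeting the base: they rule out that the line of this
  edge is the base line, so that such a meeting can only happen at \<open>P 1\<close> or \<open>P n\<close>.
\<close>

lemma simple_sides_of_interior:
  assumes "interior region \<noteq> {}"
  shows "simple_sides n P"
proof -
  have edge_edge: "z = P (i + 1) \<and> j = i + 1"
    if ij: "1 \<le> i" "i < j" "j < n" and z: "z \<in> side n P i" "z \<in> side n P j" for i j z
  proof -
    obtain u v where zv: "z = (u, v)" by force
    have i: "u \<le> x (i + 1)" "v = edge i u" and j: "x j \<le> u"
      using z ij by (auto simp: zv mem_side_edge)
    have ji: "j = i + 1" using x_less[of "i + 1" j] i(1) j ij by linarith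
    then have "u = x (i + 1)" using i j by simp
    then have "v = y (i + 1)" using i edge_right[of i] ij by (metis order_less_trans)
    then show ?thesis using ji \<open>u = x (i + 1)\<close> zv by blast
  qed
  have edge_base: "z = P 1 \<and> i = 1 \<or> z = P n \<and> i + 1 = n"
    if i: "1 \<le> i" "i < n" and z: "z \<in> side n P i" "z \<in> side n P n" for i z
  proof -
    obtain u v where zv: "z = (u, v)" by force
    have u: "x i \<le> u" "u \<le> x (i + 1)" and v: "v = edge i u"
      and b: "x 1 \<le> u" "u \<le> x n" "v = base u"
      using z i by (auto simp: zv mem_side_edge mem_side_base)
    have "\<not> (x 1 < u \<and> u < x n)"
    proof
      assume inside: "x 1 < u \<and> u < x n"
      have "edge i u = base u" using v b(3) by (rule subst)
      with inside have eq: "edge i = base"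
        by (blast intro: line_through_eq_of_touch[OF edge_le_base_ends[OF i]])
      obtain c d where cd: "(c, d) \<in> interior region" using assms by force
      then have "(c, d) \<in> region" using interior_subset by blast
      then have "edge i c < d" "d < base c"
        using cd mem_interior_region[of c d] i by (blast intro: atLeastLessThan_iff[THEN iffD2])+
      then show False unfolding eq by linarith
    qed
    then consider "u = x 1" | "u = x n" using b by linarith
    then show ?thesis
    proof cases
      case 1
      then have "i = 1" using x_less[of 1 i] u i by linarith
      then show ?thesis using 1 b by (simp add: zv)
    next
      case 2
      then have "i + 1 = n" using x_less[of "i + 1" n] u i by linarith
      then show ?thesis using 2 b base_right by (simp add: zv)
    qed
  qed
  have meet: "z \<in> {P i, P (cyc_next n i)} \<inter> {P j, P (cyc_next n j)}"
    if "1 \<le> i" "i < j" "j \<le> n" "z \<in> side n P i" "z \<in> side n P j" for i j z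
  proof (cases "j = n")
    case True
    with that have "z = P 1 \<and> i = 1 \<or> z = P n \<and> i + 1 = n" using edge_base[of i z] by blast
    then show ?thesis using True that(2) by (elim disjE conjE) (simp_all add: cyc_next_def)
  next
    case False
    then have "z = P (i + 1) \<and> j = i + 1" using edge_edge[of i j z] that by linarith
    then show ?thesis using False that(2,3) by (simp add: cyc_next_def)
  qed
  show ?thesis unfolding simple_sides_def
  proof (intro ballI impI subsetI)
    fix i j z
    assume *: "i \<in> {1..n}" "j \<in> {1..n}" "i \<noteq> j" "z \<in> side n P i \<inter> side n P j"
    then consider "i < j" | "j < i" by linarith
    then show "z \<in> {P i, P (cyc_next n i)} \<inter> {P j, P (cyc_next n j)}"
    proof cases
      case 1
      then show ?thesis using meet[of i j z] * by simp
    next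
      case 2
      then show ?thesis using meet[of j i z] * by simp
    qed
  qed
qed

lemma convex_ngon_region: "convex_ngon n P region"
proof -
  have "inj_on x {1..n}" by (rule strict_mono_on_imp_inj_on[OF mono_x])
  then have "inj_on P {1..n}" unfolding inj_on_def by blast
  then show ?thesis
    unfolding convex_ngon_def
    using three_le compact_region convex_region frontier_region simple_sides_of_interior by blast
qed

end

theorem theorem1p2:
  fixes n :: nat and x y :: "nat \<Rightarrow> real"
  assumes "n \<ge> 3"
    and "strict_mono_on {1..n} x"
  shows "(\<exists>K. convex_ngon n (\<lambda>i. (x i, y i)) K \<and>
            K \<subseteq> {(u, v). v \<le> y 1 + ((u - x 1) / (x n - x 1)) * (y n - y 1)})
     \<longleftrightarrow> (\<forall>i\<in>{2..n-1}. (y i - y (i - 1)) / (x i - x (i - 1))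
                        \<le> (y (i + 1) - y i) / (x (i + 1) - x i))"
    (is "?polygon \<longleftrightarrow> ?slopes")
proof
  interpret x_increasing_polygon n x y using assms by unfold_locales
  assume ?polygon
  then obtain K where "convex_ngon n P K" "\<And>u v. (u, v) \<in> K \<Longrightarrow> v \<le> base u"
    by (auto simp: line_through_def)
  then show ?slopes using slope_mono_of_convex_ngon assms(1) by auto
next
  assume ?slopes
  then interpret slope_increasing_polygon n x y
    using assms by unfold_locales auto
  have "region \<subseteq> {(u, v). v \<le> y 1 + ((u - x 1) / (x n - x 1)) * (y n - y 1)}"
    by (auto simp: region_def line_through_def)
  then show ?polygon using convex_ngon_region by blast
qed

end
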